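(* Let $G$ be a locally compact group, let $1\le p<\infty$, let $a\in G$ be an element passing through compact subsets, and let $\omega:G\to(0,\infty)$ be a weight function. Let $K\subset G$ be a compact subset with $\lambda(K)>0$, and suppose that for each compact subset $\Delta\subset G$ with positive measure there are a sequence $(E_k)$ of Borel subsets of $\Delta$ and a strictly increasing sequence $(n_k)$ of positive integers such that: (i) $\lambda(E_k)\to\lambda(\Delta)$ and $\displaystyle\lim_{k\to\infty}\ \underset{x\in E_k}{\mathrm{ess\,sup}}\ \tilde{\omega}_{n_k}(x)=0$; (ii) $\displaystyle\lim_{k\to\infty}\ \underset{x\in K}{\mathrm{ess\,sup}}\ \omega_{n_k}(x)=0$. Then the operator $T_{a,\omega}$ on $L^p(G)$ is $J$-class with $J$-vector $\chi_K$, i.e. $J_{T_{a,\omega}}(\chi_K)=L^p(G)$.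
   Context: $G$ is a locally compact group with right Haar measure $\lambda$, and $L^p(G)$ is the complex $L^p$-space of Borel functions with respect to $\lambda$; $\chi_K$ is the indicator function of $K$. An element $a\in G$ passes through compact subsets if for each compact $K'\subset G$ there is $N\in\mathbb{N}$ such that $K'\cap K'a^{m}=\emptyset$ and $K'\cap K'a^{-m}=\emptyset$ for all $m\ge N$. A weight is a continuous function $\omega:G\to(0,\infty)$. The weighted translation operator $T_{a,\omega}:L^p(G)\to L^p(G)$ is $(T_{a,\omega}f)(x)=\omega(x)f(xa^{-1})$; $\omega$ is assumed to be such that this is a bounded linear operator on $L^p(G)$. For $m\in\mathbb{N}$, $\tilde{\omega}_m(x)=\left(\prod_{i=0}^{m-1}\omega(xa^{-i})\right)^{-1}$ and $\omega_m(x)=\prod_{i=1}^{m}\omega(xa^{i})$. For a bounded linear operator $T$ on a Banach space $X$ (not necessarily separable) and $x\in X$, the extended limit set $J_T(x)$ is the set of all $y\in X$ for which there exist a strictly increasing sequence of positive integers $(n_k)$ and a sequence $(x_k)$ in $X$ with $x_k\to x$ and $T^{n_k}x_k\to y$. $T$ is $J$-class if $J_T(x)=X$ for some $x\in X$; such an $x$ is called a $J$-vector for $T$. *)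

theory Defs
  imports "HOL-Analysis.Analysis" "HOL-Probability.Essential_Supremum"
begin

text \<open>
  Groups are written additively, since the library's class of (not necessarily commutative)
  topological groups is \<^class>\<open>topological_group_add\<close>: the product \<open>x y\<close> is \<open>x + y\<close>, the inverse
  is \<open>- x\<close>, so \<open>x a\<^sup>-\<^sup>1\<close> is \<open>x - a\<close>. Nothing below presupposes commutativity, hence the order of
  the summands matters.
\<close>

primrec gpow :: "'a::group_add \<Rightarrow> nat \<Rightarrow> 'a" where
  "gpow a 0 = 0"
| "gpow a (Suc m) = gpow a m + a"

definition passes_through_compacts :: "'a::topological_group_add \<Rightarrow> bool" where
  "passes_through_compacts a \<longleftrightarrow>
     (\<forall>K. compact K \<longrightarrow> (\<exists>N. \<forall>m\<ge>N.
        K \<inter> (\<lambda>x. x + gpow a m) ` K = {} \<and> K \<inter> (\<lambda>x. x - gpow a m) ` K = {}))"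

text \<open>
  A right Haar measure is a nonzero right-invariant Radon measure. Radon means: a Borel measure,
  finite on compact sets, outer regular on Borel sets and inner regular on open sets.
\<close>

definition radon_measure :: "'a::topological_space measure \<Rightarrow> bool" where
  "radon_measure M \<longleftrightarrow>
     sets M = sets borel \<and>
     (\<forall>K. compact K \<longrightarrow> emeasure M K < \<infinity>) \<and>
     (\<forall>A\<in>sets borel. emeasure M A = (INF U\<in>{U. open U \<and> A \<subseteq> U}. emeasure M U)) \<and>
     (\<forall>U. open U \<longrightarrow> emeasure M U = (SUP K\<in>{K. compact K \<and> K \<subseteq> U}. emeasure M K))"

definition right_haar_measure :: "'a::topological_group_add measure \<Rightarrow> bool" where
  "right_haar_measure M \<longleftrightarrow>
     radon_measure M \<and> emeasure M UNIV \<noteq> 0 \<and>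
     (\<forall>A\<in>sets borel. \<forall>g. emeasure M ((\<lambda>x. x + g) ` A) = emeasure M A)"

text \<open>
  Elements of \<open>L\<^sup>p\<close> are represented by functions. Two representatives of one class have distance
  \<open>0\<close>, and every notion below is invariant under changing representatives.
\<close>

definition Lp :: "'a measure \<Rightarrow> real \<Rightarrow> ('a \<Rightarrow> complex) set" where
  "Lp M p = {f \<in> borel_measurable M. integrable M (\<lambda>x. norm (f x) powr p)}"

definition Lp_norm :: "'a measure \<Rightarrow> real \<Rightarrow> ('a \<Rightarrow> complex) \<Rightarrow> real" where
  "Lp_norm M p f = (\<integral>x. norm (f x) powr p \<partial>M) powr (1 / p)"

definition Lp_dist :: "'a measure \<Rightarrow> real \<Rightarrow> ('a \<Rightarrow> complex) \<Rightarrow> ('a \<Rightarrow> complex) \<Rightarrow> real" where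
  "Lp_dist M p f g = Lp_norm M p (\<lambda>x. f x - g x)"

definition bounded_linear_on_Lp ::
  "'a measure \<Rightarrow> real \<Rightarrow> (('a \<Rightarrow> complex) \<Rightarrow> ('a \<Rightarrow> complex)) \<Rightarrow> bool" where
  "bounded_linear_on_Lp M p T \<longleftrightarrow>
     (\<forall>f\<in>Lp M p. T f \<in> Lp M p) \<and>
     (\<forall>f\<in>Lp M p. \<forall>g\<in>Lp M p. AE x in M. T (\<lambda>x. f x + g x) x = T f x + T g x) \<and>
     (\<forall>f\<in>Lp M p. \<forall>c. AE x in M. T (\<lambda>x. c * f x) x = c * T f x) \<and>
     (\<exists>C. \<forall>f\<in>Lp M p. Lp_norm M p (T f) \<le> C * Lp_norm M p f)"

definition is_weight :: "('a::topological_space \<Rightarrow> real) \<Rightarrow> bool" where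
  "is_weight \<omega> \<longleftrightarrow> continuous_on UNIV \<omega> \<and> (\<forall>x. 0 < \<omega> x)"

definition weighted_translation ::
  "'a::group_add \<Rightarrow> ('a \<Rightarrow> real) \<Rightarrow> ('a \<Rightarrow> complex) \<Rightarrow> ('a \<Rightarrow> complex)" where
  "weighted_translation a \<omega> f = (\<lambda>x. complex_of_real (\<omega> x) * f (x - a))"

definition weight_bwd :: "'a::group_add \<Rightarrow> ('a \<Rightarrow> real) \<Rightarrow> nat \<Rightarrow> 'a \<Rightarrow> real" where
  "weight_bwd a \<omega> m x = inverse (\<Prod>i<m. \<omega> (x - gpow a i))"

definition weight_fwd :: "'a::group_add \<Rightarrow> ('a \<Rightarrow> real) \<Rightarrow> nat \<Rightarrow> 'a \<Rightarrow> real" where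
  "weight_fwd a \<omega> m x = (\<Prod>i=1..m. \<omega> (x + gpow a i))"

text \<open>
  The essential supremum of a nonnegative function over a Borel set \<open>E\<close>, with values in
  \<open>[0, \<infinity>]\<close>; it is \<open>0\<close> if \<open>E\<close> is a null set.
\<close>

definition esssup_on :: "'a measure \<Rightarrow> 'a set \<Rightarrow> ('a \<Rightarrow> real) \<Rightarrow> ennreal" where
  "esssup_on M E f = esssup (restrict_space M E) (\<lambda>x. ennreal (f x))"

text \<open>
  The space is given by its carrier \<open>X\<close> and the distance \<open>d\<close> induced by its norm, because
  \<open>L\<^sup>p\<close> over a given measure is not a type.
\<close>

definition extended_limit_set ::
  "'v set \<Rightarrow> ('v \<Rightarrow> 'v \<Rightarrow> real) \<Rightarrow> ('v \<Rightarrow> 'v) \<Rightarrow> 'v \<Rightarrow> 'v set" where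
  "extended_limit_set X d T x = {y \<in> X. \<exists>(n :: nat \<Rightarrow> nat) (xs :: nat \<Rightarrow> 'v).
     strict_mono n \<and> (\<forall>k. 0 < n k) \<and> (\<forall>k. xs k \<in> X) \<and>
     (\<lambda>k. d (xs k) x) \<longlonglongrightarrow> 0 \<and> (\<lambda>k. d ((T ^^ n k) (xs k)) y) \<longlonglongrightarrow> 0}"

definition J_vector :: "'v set \<Rightarrow> ('v \<Rightarrow> 'v \<Rightarrow> real) \<Rightarrow> ('v \<Rightarrow> 'v) \<Rightarrow> 'v \<Rightarrow> bool" where
  "J_vector X d T x \<longleftrightarrow> x \<in> X \<and> extended_limit_set X d T x = X"

definition J_class :: "'v set \<Rightarrow> ('v \<Rightarrow> 'v \<Rightarrow> real) \<Rightarrow> ('v \<Rightarrow> 'v) \<Rightarrow> bool" where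
  "J_class X d T \<longleftrightarrow> (\<exists>x. J_vector X d T x)"

end

theory Submission
  imports Defs
begin

text \<open>
  With \<open>S\<^sub>n g x = \<omega>\<^sub>n(x)\<^sup>-\<^sup>1 g(x a\<^sup>n)\<close> one has \<open>T\<^sup>n S\<^sub>n g = g\<close>, and right invariance turns
  the norms of \<open>S\<^sub>n g\<close> and \<open>T\<^sup>n \<chi>\<^sub>K\<close> into integrals of \<open>|g|\<^sup>p\<close> and \<open>\<chi>\<^sub>K\<close> weighted by the
  \<open>p\<close>-th powers of the backward and the forward product of the weight. Given \<open>f \<in> L\<^sup>p\<close>, take a
  compact set \<open>D\<close> on which \<open>f\<close> is bounded and off which it has small norm, and apply the
  hypothesis to \<open>D \<union> K\<close>. For \<open>g = f \<chi>\<^bsub>E\<^sub>k \<inter> D\<^esub>\<close> and \<open>z = \<chi>\<^sub>K + S\<^sub>n g\<close> with \<open>n = n\<^sub>k\<close>, both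
  \<open>z - \<chi>\<^sub>K = S\<^sub>n g\<close> and \<open>T\<^sup>n z - f = T\<^sup>n \<chi>\<^sub>K + (g - f)\<close> are small for large \<open>k\<close>. Using
  \<open>D \<union> K\<close> instead of \<open>D\<close> avoids a separate treatment of null sets \<open>D\<close>.
\<close>

section \<open>Radon measures\<close>

text \<open>\<open>radon_measure\<close> grants inner regularity on open sets only. Combined with
  outer regularity it passes to Borel sets of finite measure; finiteness turns closeness of two
  measures into smallness of the difference set.\<close>

lemma radon_inner_approx:
  fixes M :: "'a::t2_space measure"
  assumes M: "radon_measure M" and A: "A \<in> sets borel" "emeasure M A < \<infinity>" and e: "0 < e"
  obtains C where "compact C" "C \<subseteq> A" "emeasure M (A - C) \<le> e"
proof -
  have sets[simp, measurable_cong]: "sets M = sets borel" using M by (simp add: radon_measure_def)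
  have fin: "\<And>K. compact K \<Longrightarrow> emeasure M K < \<infinity>" using M by (simp add: radon_measure_def)
  have outer: "\<exists>U. open U \<and> B \<subseteq> U \<and> emeasure M U < c"
    if "B \<in> sets borel" "emeasure M B < c" for B c
  proof -
    have "(INF U\<in>{U. open U \<and> B \<subseteq> U}. emeasure M U) < c"
      using M that by (simp add: radon_measure_def)
    then show ?thesis by (auto simp: INF_less_iff)
  qed
  \<comment> \<open>The approximating set is \<open>F - V\<close>, for \<open>F\<close> compact and nearly all of an open \<open>U \<supseteq> A\<close>, and
    \<open>V\<close> open, small and containing \<open>U - A\<close>.\<close>
  define d where "d = min (e / 2) 1"
  \<comment> \<open>Two errors of size at most \<open>d\<close> have to fit into \<open>e\<close>,
    hence the half. The cap at 1 keeps \<open>d\<close> finite even if \<open>e\<close> is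
    infinite.\<close>
  have d: "0 < d" "d < top" "d + d \<le> e"
  proof -
    show "0 < d" using e by (simp add: d_def ennreal_zero_less_divide)
    show "d < top" by (simp add: d_def min_less_iff_disj)
    have "d + d \<le> e / 2 + e / 2" by (intro add_mono) (simp_all add: d_def)
    also have "\<dots> = e" by (simp add: ennreal_divide_times flip: mult_2_right)
    finally show "d + d \<le> e" .
  qed
  have "emeasure M A < emeasure M A + d" using A d by simp
  then obtain U where U: "open U" "A \<subseteq> U" "emeasure M U < emeasure M A + d"
    using outer A by blast
  have [measurable]: "U \<in> sets borel" "A \<in> sets borel" using U A by auto
  have UA: "emeasure M (U - A) < d"
  proof -
    have "emeasure M U = emeasure M A + emeasure M (U - A)"
      using U by (subst plus_emeasure) (auto intro!: arg_cong[where f="emeasure M"])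
    then show ?thesis using U(3) A by simp
  qed
  have Ufin: "emeasure M U < top"
    using U(3) A d by (auto intro: order.strict_trans)
  obtain V where V: "open V" "U - A \<subseteq> V" "emeasure M V < d"
    using outer[of "U - A" d] UA by auto
  obtain F where F: "compact F" "F \<subseteq> U" "emeasure M U \<le> emeasure M F + d"
  \<comment> \<open>Below, a value strictly smaller than the supremum is required, and
    \<open>emeasure M U - d\<close> is one only if \<open>U\<close> is not null; for a null
    \<open>U\<close> the empty set serves.\<close>
  proof (cases "emeasure M U = 0")
    case True
    then show ?thesis using that[of "{}"] by simp
  next
    case False
    then have "emeasure M U - d < emeasure M U"
      using d Ufin by (intro ennreal_between) (auto simp: zero_less_iff_neq_zero)
    also have "emeasure M U = (SUP K\<in>{K. compact K \<and> K \<subseteq> U}. emeasure M K)"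
      using M U(1) unfolding radon_measure_def by blast
    finally obtain F where "compact F" "F \<subseteq> U" "emeasure M U - d < emeasure M F"
      by (auto simp: less_SUP_iff)
    then show ?thesis using that[of F] by (metis add.commute ennreal_minus_le_iff less_imp_le)
  qed
  have [measurable]: "F \<in> sets borel" "V \<in> sets borel"
    using F V by (auto simp: compact_imp_closed)
  have UF: "emeasure M (U - F) \<le> d"
  proof -
    have "emeasure M U = emeasure M F + emeasure M (U - F)"
      using F by (subst plus_emeasure) (auto intro!: arg_cong[where f="emeasure M"])
    then show ?thesis using F(3) fin[OF F(1)] by (simp flip: less_top)
  qed
  show ?thesis
  proof (rule that[of "F - V"])
    show "compact (F - V)" using F V by (simp add: compact_diff)
    show "F - V \<subseteq> A" using F V by auto
    have "emeasure M (A - (F - V)) \<le> emeasure M ((U - F) \<union> V)"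
      using U by (intro emeasure_mono) auto
    also have "\<dots> \<le> emeasure M (U - F) + emeasure M V"
      by (intro emeasure_subadditive) auto
    also have "\<dots> \<le> d + d" using UF V by (intro add_mono) auto
    also have "\<dots> \<le> e" by (rule d)
    finally show "emeasure M (A - (F - V)) \<le> e" .
  qed
qed

text \<open>To be applied to \<open>h = |f|^p\<close>: it yields the compact set on which
  \<open>f\<close> is bounded and off which \<open>f\<close> is small in norm. The zero set of
  \<open>h\<close> costs nothing, and the rest is exhausted by sets of finite measure with
  \<open>h\<close> bounded, which \<open>radon_inner_approx\<close> replaces by compact
  ones.\<close>

lemma radon_compact_tail:
  fixes M :: "'a::t2_space measure" and h :: "'a \<Rightarrow> real"
  assumes M: "radon_measure M" and h: "h \<in> borel_measurable M" "\<And>x. 0 \<le> h x"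
    and fin: "(\<integral>\<^sup>+x. ennreal (h x) \<partial>M) < \<infinity>" and e: "0 < (e::real)"
  obtains D C where "compact D" "0 \<le> C" "\<And>x. x \<in> D \<Longrightarrow> h x \<le> C"
    "(\<integral>\<^sup>+x. ennreal (h x) * indicator (- D) x \<partial>M) \<le> ennreal e"
proof -
  have sets[simp, measurable_cong]: "sets M = sets borel" using M by (simp add: radon_measure_def)
  have space[simp]: "space M = UNIV" using sets_eq_imp_space_eq[OF sets] by simp
  note h(1)[measurable]
  \<comment> \<open>The lower bound \<open>1 / (n + 1)\<close> on \<open>h\<close> makes
    \<open>B n\<close> a set of finite measure by Markov's inequality; the upper bound becomes the
    constant \<open>C\<close>. Every point with \<open>h x \<noteq> 0\<close> lies in
    \<open>B n\<close> for all large \<open>n\<close>, so dominated convergence makes the integral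
    off \<open>B n\<close> small.\<close>
  define B where "B n = {x. 1 \<le> real (Suc n) * h x \<and> h x \<le> real n}" for n
  have [measurable]: "B n \<in> sets borel" for n unfolding B_def by measurable
  have "(\<lambda>n. \<integral>\<^sup>+x. ennreal (h x) * indicator (- B n) x \<partial>M) \<longlonglongrightarrow> (\<integral>\<^sup>+x. 0 \<partial>M)"
  proof (rule nn_integral_dominated_convergence[where w="\<lambda>x. ennreal (h x)"])
    show "AE x in M. (\<lambda>n. ennreal (h x) * indicator (- B n) x) \<longlonglongrightarrow> 0"
    proof (rule AE_I2, rule tendsto_eventually)
      fix x
      show "\<forall>\<^sub>F n in sequentially. ennreal (h x) * indicator (- B n) x = 0"
      proof (cases "h x = 0")
        case False
        then have pos: "0 < h x" using h(2)[of x] by simp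
        obtain m :: nat where m: "max (h x) (1 / h x) \<le> real m" using real_arch_simple by blast
        have "x \<in> B n" if "m \<le> n" for n
        proof -
          have "1 / h x \<le> real (Suc n)" "h x \<le> real n" using m that by auto
          then show ?thesis using pos by (simp add: B_def divide_simps)
        qed
        then show ?thesis by (intro eventually_sequentiallyI[of m]) simp
      qed simp
    qed
  qed (use fin in \<open>auto intro!: AE_I2 simp: indicator_def\<close>)
  then have "\<forall>\<^sub>F n in sequentially.
      (\<integral>\<^sup>+x. ennreal (h x) * indicator (- B n) x \<partial>M) < ennreal (e / 2)"
    using e by (intro order_tendstoD(2)) auto
  then obtain n where n: "(\<integral>\<^sup>+x. ennreal (h x) * indicator (- B n) x \<partial>M) < ennreal (e / 2)"
    by (auto simp: eventually_sequentially)
  have "emeasure M (B n) \<le> emeasure M {x \<in> UNIV. 1 \<le> ennreal (real (Suc n)) * ennreal (h x)}"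
    using h(2) by (intro emeasure_mono)
      (auto simp: B_def simp del: of_nat_Suc simp flip: ennreal_mult'' ennreal_1)
  also have "\<dots> \<le> ennreal (real (Suc n)) * (\<integral>\<^sup>+x. ennreal (h x) * indicator UNIV x \<partial>M)"
    by (intro nn_integral_Markov_inequality) auto
  also have "\<dots> < \<infinity>" using fin by (simp add: ennreal_mult_less_top del: of_nat_Suc)
  finally have "emeasure M (B n) < \<infinity>" .
  \<comment> \<open>Since \<open>h \<le> n\<close> on \<open>B n\<close>, the part of
    \<open>B n\<close> outside \<open>D\<close> contributes at most
    \<open>n * r \<le> e / 2\<close>. Taking \<open>Suc n\<close> avoids division by zero.\<close>
  moreover define r where "r = e / (2 * real (Suc n))"
  moreover have r: "0 < r" using e by (simp add: r_def)
  ultimately obtain D where D: "compact D" "D \<subseteq> B n" "emeasure M (B n - D) \<le> ennreal r"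
    using radon_inner_approx[OF M, of "B n" "ennreal r"] by auto
  have [measurable]: "D \<in> sets borel" using D by (simp add: compact_imp_closed)
  have "(\<integral>\<^sup>+x. ennreal (h x) * indicator (- D) x \<partial>M)
      \<le> (\<integral>\<^sup>+x. ennreal (h x) * indicator (- B n) x + ennreal (real n) * indicator (B n - D) x \<partial>M)"
  proof (intro nn_integral_mono)
    fix x
    show "ennreal (h x) * indicator (- D) x
        \<le> ennreal (h x) * indicator (- B n) x + ennreal (real n) * indicator (B n - D) x"
      using h(2)[of x] D(2) by (auto simp: indicator_def B_def intro: ennreal_leI)
  qed
  also have "\<dots> = (\<integral>\<^sup>+x. ennreal (h x) * indicator (- B n) x \<partial>M)
      + ennreal (real n) * emeasure M (B n - D)"
    by (subst nn_integral_add) (auto simp: nn_integral_cmult_indicator)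
  also have "\<dots> \<le> ennreal (e / 2) + ennreal (real n) * ennreal r"
    using n D by (intro add_mono mult_mono) auto
  also have "\<dots> = ennreal (e / 2 + real n * r)"
    using e r by (simp add: ennreal_mult'' ennreal_plus)
  also have "\<dots> \<le> ennreal e"
    using e by (intro ennreal_leI) (simp add: r_def divide_simps algebra_simps)
  finally show ?thesis
    using that[of D "real n"] D by (auto simp: B_def)
qed

text \<open>Invariance is assumed for images of sets. A preimage under right translation by
  \<open>g\<close> is the image under right translation by \<open>- g\<close>, so \<open>M\<close>
  is its own image measure and the change of variables formula applies.\<close>

lemma right_haar_nn_integral_translate:
  assumes M: "right_haar_measure M" and f: "f \<in> borel_measurable M"
  shows "(\<integral>\<^sup>+x. f (x + g) \<partial>M) = (\<integral>\<^sup>+x. f x \<partial>M)"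
proof -
  have sets[simp, measurable_cong]: "sets M = sets borel"
    using M by (simp add: right_haar_measure_def radon_measure_def)
  have space[simp]: "space M = UNIV" using sets_eq_imp_space_eq[OF sets] by simp
  have [measurable]: "(\<lambda>x. x + g) \<in> M \<rightarrow>\<^sub>M M"
    by (subst measurable_cong_sets[OF sets sets])
       (intro borel_measurable_continuous_onI continuous_intros)
  have "distr M M (\<lambda>x. x + g) = M"
  proof (rule measure_eqI)
    fix A assume "A \<in> sets (distr M M (\<lambda>x. x + g))"
    then have A: "A \<in> sets borel" by simp
    have "(\<lambda>x. x + g) -` A = (\<lambda>x. x + - g) ` A"
      by (auto simp: image_iff eq_diff_eq)
    then show "emeasure (distr M M (\<lambda>x. x + g)) A = emeasure M A"
      using M A by (simp add: emeasure_distr right_haar_measure_def del: add_uminus_conv_diff)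
  qed simp
  then have "(\<integral>\<^sup>+x. f x \<partial>M) = (\<integral>\<^sup>+x. f x \<partial>distr M M (\<lambda>x. x + g))" by simp
  also have "\<dots> = (\<integral>\<^sup>+x. f (x + g) \<partial>M)" using f by (subst nn_integral_distr) auto
  finally show ?thesis by simp
qed

section \<open>Membership and convergence in \<open>L\<^sup>p\<close>\<close>

lemma Lp_iff_nn_integral:
  "f \<in> Lp M p \<longleftrightarrow> f \<in> borel_measurable M \<and> (\<integral>\<^sup>+x. ennreal (norm (f x) powr p) \<partial>M) < \<infinity>"
  by (auto simp: Lp_def integrable_iff_bounded)

lemma Lp_norm_le:
  assumes "f \<in> borel_measurable M" and p: "0 < p" and e: "0 \<le> e"
    and le: "(\<integral>\<^sup>+x. ennreal (norm (f x) powr p) \<partial>M) \<le> ennreal e"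
  shows "Lp_norm M p f \<le> e powr (1 / p)"
proof -
  have "(\<integral>x. norm (f x) powr p \<partial>M) = enn2real (\<integral>\<^sup>+x. ennreal (norm (f x) powr p) \<partial>M)"
    using assms(1) by (intro integral_eq_nn_integral) auto
  also have "\<dots> \<le> e" using le e by (metis enn2real_leI)
  finally show ?thesis
    unfolding Lp_norm_def using p by (intro powr_mono2) auto
qed

text \<open>A sum has norm at most twice the larger of the two norms. This crude bound takes the
  place of Minkowski's inequality; the factor \<open>2 powr p\<close> is absorbed when the constants
  are chosen.\<close>

lemma norm_add_powr_le:
  fixes u v :: "'b::real_normed_vector"
  assumes "0 \<le> p"
  shows "norm (u + v) powr p \<le> 2 powr p * (norm u powr p + norm v powr p)"
proof -
  have "norm (u + v) powr p \<le> (2 * max (norm u) (norm v)) powr p"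
    using assms norm_triangle_ineq[of u v] by (intro powr_mono2) auto
  also have "\<dots> = 2 powr p * max (norm u) (norm v) powr p"
    by (simp add: powr_mult)
  also have "\<dots> \<le> 2 powr p * (norm u powr p + norm v powr p)"
    by (intro mult_left_mono) (auto simp: max_def)
  finally show ?thesis .
qed

lemma nn_integral_norm_add_powr_le:
  fixes u v :: "'a \<Rightarrow> complex"
  assumes [measurable]: "u \<in> borel_measurable M" "v \<in> borel_measurable M" and p: "0 \<le> p"
  shows "(\<integral>\<^sup>+x. ennreal (norm (u x + v x) powr p) \<partial>M) \<le>
    ennreal (2 powr p) * ((\<integral>\<^sup>+x. ennreal (norm (u x) powr p) \<partial>M)
      + (\<integral>\<^sup>+x. ennreal (norm (v x) powr p) \<partial>M))"
proof -
  have "(\<integral>\<^sup>+x. ennreal (norm (u x + v x) powr p) \<partial>M) \<le>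
     (\<integral>\<^sup>+x. ennreal (2 powr p) * (ennreal (norm (u x) powr p) + ennreal (norm (v x) powr p)) \<partial>M)"
    using norm_add_powr_le[OF p]
    by (intro nn_integral_mono) (simp flip: ennreal_plus ennreal_mult)
  also have "\<dots> = ennreal (2 powr p) * ((\<integral>\<^sup>+x. ennreal (norm (u x) powr p) \<partial>M)
      + (\<integral>\<^sup>+x. ennreal (norm (v x) powr p) \<partial>M))"
    by (subst nn_integral_cmult) (auto simp: nn_integral_add)
  finally show ?thesis .
qed

lemma Lp_add:
  assumes "f \<in> Lp M p" "g \<in> Lp M p" "0 \<le> p"
  shows "(\<lambda>x. f x + g x) \<in> Lp M p"
proof -
  have [measurable]: "f \<in> borel_measurable M" "g \<in> borel_measurable M"
    using assms by (auto simp: Lp_def)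
  show ?thesis
    using assms nn_integral_norm_add_powr_le[of f M g p]
    by (auto simp: Lp_iff_nn_integral ennreal_mult_less_top intro: order.strict_trans1)
qed

text \<open>Used twice: with the backward product on \<open>E k\<close> and with the forward product
  on \<open>K\<close>. The essential supremum controls \<open>\<phi>\<close> almost everywhere on
  \<open>E\<close> only, and off \<open>E\<close> the factor \<open>g\<close> vanishes.\<close>

lemma nn_integral_esssup_mult_le:
  fixes g :: "'a \<Rightarrow> complex"
  assumes E: "E \<in> sets M" and g: "g \<in> borel_measurable M" and \<phi>: "\<And>x. 0 \<le> \<phi> x"
    and p: "0 < p" and c: "0 \<le> c" and ess: "esssup_on M E \<phi> \<le> ennreal c"
    and zero: "\<And>x. x \<notin> E \<Longrightarrow> g x = 0"
  shows "(\<integral>\<^sup>+x. ennreal (norm (of_real (\<phi> x) * g x) powr p) \<partial>M)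
    \<le> ennreal (c powr p) * (\<integral>\<^sup>+x. ennreal (norm (g x) powr p) \<partial>M)"
proof -
  note g[measurable]
  have "AE x in restrict_space M E. ennreal (\<phi> x) \<le> esssup_on M E \<phi>"
    unfolding esssup_on_def by (rule esssup_AE)
  then have "AE x in M. x \<in> E \<longrightarrow> ennreal (\<phi> x) \<le> esssup_on M E \<phi>"
    using E by (subst (asm) AE_restrict_space_iff) auto
  then have "AE x in M. ennreal (norm (of_real (\<phi> x) * g x) powr p)
      \<le> ennreal (c powr p) * ennreal (norm (g x) powr p)"
  proof eventually_elim
    case (elim x)
    show ?case
    proof (cases "x \<in> E")
      case True
      then have "ennreal (\<phi> x) \<le> ennreal c" using elim ess by (auto intro: order_trans)
      then have "\<phi> x \<le> c" using c by simp
      then have "norm (of_real (\<phi> x) * g x) powr p \<le> (c * norm (g x)) powr p"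
        using p \<phi>[of x] by (intro powr_mono2) (auto simp: norm_mult intro!: mult_right_mono)
      then show ?thesis using c by (simp add: powr_mult flip: ennreal_mult)
    qed (simp add: zero)
  qed
  then have "(\<integral>\<^sup>+x. ennreal (norm (of_real (\<phi> x) * g x) powr p) \<partial>M)
      \<le> (\<integral>\<^sup>+x. ennreal (c powr p) * ennreal (norm (g x) powr p) \<partial>M)"
    by (rule nn_integral_mono_AE)
  then show ?thesis by (simp add: nn_integral_cmult)
qed

section \<open>Weighted translations and extended limit sets\<close>

lemma gpow_add: "gpow a (m + n) = gpow a m + gpow a n"
  by (induction n) (simp_all add: add.assoc)

text \<open>The product is the reciprocal of \<open>weight_bwd a \<omega> n x\<close>, which is why
  multiplication by \<open>weight_bwd\<close> followed by a translation gives a right inverse of the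
  iterate.\<close>

lemma weighted_translation_funpow:
  "(weighted_translation a \<omega> ^^ n) f x =
     of_real (\<Prod>i<n. \<omega> (x - gpow a i)) * f (x - gpow a n)"
proof (induction n arbitrary: x)
  case (Suc n)
  \<comment> \<open>\<open>gpow\<close> appends \<open>a\<close> on the right, so subtracting
    \<open>gpow a (Suc i)\<close> removes this \<open>a\<close> first; the order matters without
    commutativity.\<close>
  have "x - a - gpow a i = x - gpow a (Suc i)" for i
    by (simp add: diff_add_eq_diff_diff_swap)
  then show ?case
    using Suc[of "x - a"]
    by (simp add: weighted_translation_def[of _ _ "(weighted_translation a \<omega> ^^ n) f"]
        prod.lessThan_Suc_shift comp_def mult.assoc del: gpow.simps(2) prod.lessThan_Suc)
qed simp

text \<open>The forward product is the factor of the \<open>n\<close>-th iterate evaluated at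
  \<open>x a^n\<close>; the indices are reflected by \<open>i\<close> to \<open>n - i\<close>. Hence
  the iterate maps \<open>\<chi>_K\<close> to a translate of \<open>weight_fwd\<close> times
  \<open>\<chi>_K\<close>.\<close>

lemma weight_fwd_eq: "weight_fwd a \<omega> n x = (\<Prod>i<n. \<omega> (x + gpow a n - gpow a i))"
  unfolding weight_fwd_def
proof (rule prod.reindex_bij_witness[of _ "\<lambda>i. n - i" "\<lambda>i. n - i"])
  fix i assume "i \<in> {1..n}"
  then have "gpow a n = gpow a i + gpow a (n - i)" by (simp flip: gpow_add)
  then show "\<omega> (x + gpow a n - gpow a (n - i)) = \<omega> (x + gpow a i)"
    by (simp flip: add.assoc)
qed auto

text \<open>Diagonal choice: at stage \<open>k\<close> the accuracy is \<open>1 / (k + 1)\<close>,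
  and the freedom to exceed any \<open>N\<close> allows an exponent above the previous one. As the
  exponents must increase, the choice is dependent, made on pairs of an exponent and a
  vector.\<close>

lemma extended_limit_setI:
  assumes "y \<in> X"
    and *: "\<And>e N. 0 < e \<Longrightarrow> \<exists>n>N. \<exists>z\<in>X. d z x \<le> e \<and> d ((T ^^ n) z) y \<le> e"
    and nonneg: "\<And>u v. 0 \<le> d u v"
  shows "y \<in> extended_limit_set X d T x"
proof -
  define P where "P k s \<longleftrightarrow> 0 < fst s \<and> snd s \<in> X \<and> d (snd s) x \<le> inverse (real (Suc k))
    \<and> d ((T ^^ fst s) (snd s)) y \<le> inverse (real (Suc k))" for k and s :: "nat \<times> 'a"
  have ex: "\<exists>s. P k s \<and> N < fst s" for k N
  proof -
    obtain n z where "N < n" "z \<in> X" "d z x \<le> inverse (real (Suc k))"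
      "d ((T ^^ n) z) y \<le> inverse (real (Suc k))"
      using *[of "inverse (real (Suc k))" N] by (auto simp del: of_nat_Suc)
    then have "P k (n, z) \<and> N < fst (n, z)" by (simp add: P_def del: of_nat_Suc)
    then show ?thesis ..
  qed
  have "\<exists>f. \<forall>k. P k (f k) \<and> fst (f k) < fst (f (Suc k))"
    by (rule dependent_nat_choice) (use ex in blast)+
  then obtain f where f: "\<And>k. P k (f k)" "\<And>k. fst (f k) < fst (f (Suc k))" by blast
  have lim: "g \<longlonglongrightarrow> 0" if "\<And>k. 0 \<le> g k" "\<And>k. g k \<le> inverse (real (Suc k))"
    for g :: "nat \<Rightarrow> real"
  proof (rule tendsto_sandwich[OF _ _ tendsto_const LIMSEQ_inverse_real_of_nat])
    show "\<forall>\<^sub>F k in sequentially. 0 \<le> g k" using that(1) by (intro always_eventually allI)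
    show "\<forall>\<^sub>F k in sequentially. g k \<le> inverse (real (Suc k))"
      using that(2) by (intro always_eventually allI)
  qed
  show ?thesis
    unfolding extended_limit_set_def
  proof (intro CollectI conjI exI[of _ "\<lambda>k. fst (f k)"] exI[of _ "\<lambda>k. snd (f k)"] allI)
    show "strict_mono (\<lambda>k. fst (f k))" using f(2) by (simp add: strict_mono_Suc_iff)
    show "(\<lambda>k. d (snd (f k)) x) \<longlonglongrightarrow> 0" "(\<lambda>k. d ((T ^^ fst (f k)) (snd (f k))) y) \<longlonglongrightarrow> 0"
      using f(1) nonneg by (intro lim; simp add: P_def)+
    show "y \<in> X" by (rule assms(1))
    show "0 < fst (f k)" "snd (f k) \<in> X" for k using f(1)[of k] by (simp_all add: P_def)
  qed
qed

text \<open>Supplies the exponents and vectors that \<open>extended_limit_setI\<close> asks for. The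
  assumption \<open>ex\<close> keeps \<open>D\<close> arbitrary because \<open>D\<close> is chosen
  only inside the proof, depending on \<open>f\<close> and \<open>e\<close>.\<close>

lemma weighted_translation_approx:
  fixes M :: "'a::{topological_group_add, t2_space} measure"
  assumes M: "right_haar_measure M" and p: "0 < p" and \<omega>: "is_weight \<omega>" and K: "compact K"
    and f: "f \<in> Lp M p" and e: "0 < e"
    and ex: "\<And>D. compact D \<Longrightarrow> \<exists>E n. (\<forall>k. E k \<in> sets borel \<and> E k \<subseteq> D \<union> K) \<and>
        strict_mono n \<and>
        (\<lambda>k. emeasure M (E k)) \<longlonglongrightarrow> emeasure M (D \<union> K) \<and>
        (\<lambda>k. esssup_on M (E k) (weight_bwd a \<omega> (n k))) \<longlonglongrightarrow> 0 \<and>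
        (\<lambda>k. esssup_on M K (weight_fwd a \<omega> (n k))) \<longlonglongrightarrow> 0"
  shows "\<exists>n>N. \<exists>z\<in>Lp M p. Lp_dist M p z (indicator K) \<le> e \<and>
    Lp_dist M p ((weighted_translation a \<omega> ^^ n) z) f \<le> e"
proof -
  have radon: "radon_measure M" using M by (simp add: right_haar_measure_def)
  then have sets[simp, measurable_cong]: "sets M = sets borel" by (simp add: radon_measure_def)
  have cfin: "emeasure M C < \<infinity>" if "compact C" for C using radon that by (simp add: radon_measure_def)
  have [measurable]: "f \<in> borel_measurable borel" "K \<in> sets borel"
    using f K by (auto simp: Lp_def compact_imp_closed cong: measurable_cong_sets)
  have \<omega>pos: "0 < \<omega> x" for x using \<omega> by (simp add: is_weight_def)
  have \<omega>cont: "continuous_on UNIV \<omega>" using \<omega> by (simp add: is_weight_def)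
  have trans[measurable]: "(\<lambda>x::'a. x + b) \<in> borel \<rightarrow>\<^sub>M borel" for b
    by (intro borel_measurable_continuous_onI continuous_intros)
  have \<omega>meas[measurable]: "\<omega> \<in> borel_measurable borel"
    using \<omega>cont by (rule borel_measurable_continuous_onI)
  have trans'[measurable]: "(\<lambda>x::'a. x - b) \<in> borel \<rightarrow>\<^sub>M borel" for b
    using trans[of "- b"] by simp
  have bwd_meas[measurable]: "weight_bwd a \<omega> n \<in> borel_measurable borel" for n
    unfolding weight_bwd_def by measurable
  have fwd_meas[measurable]: "weight_fwd a \<omega> n \<in> borel_measurable borel" for n
    unfolding weight_fwd_def by measurable
  have bwd_nonneg: "0 \<le> weight_bwd a \<omega> n x" and fwd_nonneg: "0 \<le> weight_fwd a \<omega> n x" for n x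
    using \<omega>pos by (auto simp: weight_bwd_def weight_fwd_def intro!: prod_nonneg intro: less_imp_le)
  let ?I = "\<lambda>u. \<integral>\<^sup>+x. ennreal (norm (u x :: complex) powr p) \<partial>M"
  define F where "F = enn2real (?I f)"
  define m where "m = enn2real (emeasure M K)"
  have IF: "?I f = ennreal F" using f by (simp add: F_def Lp_iff_nn_integral)
  have mK: "emeasure M K = ennreal m" using cfin[OF K] by (simp add: m_def)
  have Fm: "0 \<le> F" "0 \<le> m" by (simp_all add: F_def m_def)
  \<comment> \<open>Errors are measured as \<open>p\<close>-th powers of norms. The error at
    \<open>f\<close> consists of \<open>q\<close> from \<open>\<chi>_K\<close> and
    \<open>2 * q\<close> from \<open>g - f\<close>, times \<open>2 powr p\<close> for the sum;
    \<open>q\<close> makes the total exactly \<open>r\<close>.\<close>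
  define r where "r = e powr p"
  define q where "q = r / (2 powr p * 3)"
  have r: "0 < r" using e by (simp add: r_def)
  then have q: "0 < q" by (simp add: q_def)
  \<comment> \<open>One bound on both weight products gives \<open>c powr p * F \<le> r\<close> and
    \<open>c powr p * m \<le> q\<close>; the summand 1 keeps the denominator positive.\<close>
  define c where "c = (min q r / (1 + F + m)) powr (1 / p)"
  have c: "0 < c" using r q Fm by (simp add: c_def)
  have cp: "c powr p = min q r / (1 + F + m)" using r q Fm p by (simp add: c_def powr_powr)
  have "F \<le> 1 + F + m" "m \<le> 1 + F + m" using Fm by auto
  then have cF: "c powr p * F \<le> r" and cm: "c powr p * m \<le> q"
    using Fm r q mult_mono[of "min q r" r F "1 + F + m"] mult_mono[of "min q r" q m "1 + F + m"]
    by (auto simp: cp divide_simps)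
  have h: "(\<lambda>x. norm (f x) powr p) \<in> borel_measurable M" by measurable
  obtain D C where D: "compact D" "0 \<le> C" "\<And>x. x \<in> D \<Longrightarrow> norm (f x) powr p \<le> C"
    "(\<integral>\<^sup>+x. ennreal (norm (f x) powr p) * indicator (- D) x \<partial>M) \<le> ennreal q"
    using radon_compact_tail[OF radon h _ _ q] IF by auto
  have [measurable]: "D \<in> sets borel" using D by (simp add: compact_imp_closed)
  obtain E n where E: "\<And>k. E k \<in> sets borel" "\<And>k. E k \<subseteq> D \<union> K" and n: "strict_mono n"
    and lim: "(\<lambda>k. emeasure M (E k)) \<longlonglongrightarrow> emeasure M (D \<union> K)"
      "(\<lambda>k. esssup_on M (E k) (weight_bwd a \<omega> (n k))) \<longlonglongrightarrow> 0"
      "(\<lambda>k. esssup_on M K (weight_fwd a \<omega> (n k))) \<longlonglongrightarrow> 0"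
    using ex[OF D(1)] by blast
  have DKfin: "emeasure M (D \<union> K) < top" using cfin[of "D \<union> K"] D K by (simp add: compact_Un)
  have Efin: "emeasure M (E k) \<noteq> top" for k
    using DKfin emeasure_mono[OF E(2), of M k] by (auto simp: top_unique)
  \<comment> \<open>All measures involved are finite, so convergence of the measures of
    \<open>E k\<close> says that the missing part of \<open>D \<union> K\<close> shrinks to measure
    0.\<close>
  have "(\<lambda>k. emeasure M (D \<union> K) - emeasure M (E k))
      \<longlonglongrightarrow> emeasure M (D \<union> K) - emeasure M (D \<union> K)"
    using lim(1) DKfin by (intro tendsto_diff_ennreal tendsto_const) auto
  then have "(\<lambda>k. emeasure M (D \<union> K - E k)) \<longlonglongrightarrow> 0"
    using E DKfin Efin by (simp add: emeasure_Diff)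
  \<comment> \<open>On a set this small a function bounded by \<open>C\<close> has integral at most
    \<open>q\<close>; \<open>C + 1\<close> covers \<open>C = 0\<close>.\<close>
  then have "\<forall>\<^sub>F k in sequentially. emeasure M (D \<union> K - E k) < ennreal (q / (C + 1))"
    using q D by (intro order_tendstoD(2)) auto
  moreover have "\<forall>\<^sub>F k in sequentially. esssup_on M (E k) (weight_bwd a \<omega> (n k)) < ennreal c"
      "\<forall>\<^sub>F k in sequentially. esssup_on M K (weight_fwd a \<omega> (n k)) < ennreal c"
    using lim(2,3) c by (auto intro!: order_tendstoD(2))
  moreover have "\<forall>\<^sub>F k in sequentially. N < k" by (rule eventually_gt_at_top)
  ultimately have "\<forall>\<^sub>F k in sequentially. emeasure M (D \<union> K - E k) < ennreal (q / (C + 1))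
      \<and> esssup_on M (E k) (weight_bwd a \<omega> (n k)) < ennreal c
      \<and> esssup_on M K (weight_fwd a \<omega> (n k)) < ennreal c \<and> N < k"
    by eventually_elim simp
  then obtain k where k: "emeasure M (D \<union> K - E k) < ennreal (q / (C + 1))"
      "esssup_on M (E k) (weight_bwd a \<omega> (n k)) < ennreal c"
      "esssup_on M K (weight_fwd a \<omega> (n k)) < ennreal c" "N < k"
    by (auto simp: eventually_sequentially)
  note E(1)[of k, measurable]
  have nk: "N < n k" using k(4) seq_suble[OF n, of k] by simp
  define t where "t = gpow a (n k)"
  define g where "g x = f x * indicator (E k \<inter> D) x" for x
  \<comment> \<open>\<open>v (x + t)\<close> is \<open>S_n g\<close> and \<open>u (x - t)\<close> is
    the iterate of \<open>\<chi>_K\<close>. Before translation the weights are evaluated on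
    \<open>E k\<close> and \<open>K\<close>, exactly where they are known to be small.\<close>
  define v where "v x = of_real (weight_bwd a \<omega> (n k) x) * g x" for x
  define u where "u x = of_real (weight_fwd a \<omega> (n k) x) * (indicator K x :: complex)" for x
  define z where "z x = indicator K x + v (x + t)" for x
  have [measurable]: "g \<in> borel_measurable borel" unfolding g_def by measurable
  have [measurable]: "v \<in> borel_measurable borel" "u \<in> borel_measurable borel"
    unfolding v_def u_def by measurable
  have Tz: "(weighted_translation a \<omega> ^^ n k) z x = u (x - t) + g x" for x
  proof -
    have "(\<Prod>i<n k. \<omega> (x - gpow a i)) \<noteq> 0"
      using \<omega>pos by (auto simp: prod_zero_iff less_le)
    then show ?thesis
      by (simp add: weighted_translation_funpow z_def u_def v_def weight_fwd_eq weight_bwd_def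
          t_def algebra_simps flip: of_real_mult of_real_prod)
  qed
  have Iv: "?I v \<le> ennreal r"
  proof -
    have "?I v \<le> ennreal (c powr p) * ?I g"
      unfolding v_def using k(2) p c bwd_nonneg
      by (intro nn_integral_esssup_mult_le[where E="E k"])
         (auto simp: g_def)
    also have "\<dots> \<le> ennreal (c powr p) * ?I f"
      by (intro mult_left_mono nn_integral_mono) (auto simp: g_def indicator_def)
    also have "\<dots> \<le> ennreal r" using cF Fm by (auto simp: IF simp flip: ennreal_mult intro!: ennreal_leI)
    finally show ?thesis .
  qed
  have IK: "?I (indicator K) = ennreal m"
  proof -
    have "?I (indicator K) = (\<integral>\<^sup>+x. indicator K x \<partial>M)"
      by (intro nn_integral_cong) (auto simp: indicator_def)
    then show ?thesis by (simp add: mK)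
  qed
  have Iu: "?I u \<le> ennreal q"
  proof -
    have "?I u \<le> ennreal (c powr p) * ?I (indicator K)"
      unfolding u_def using k(3) p c fwd_nonneg
      by (intro nn_integral_esssup_mult_le[where E="K"]) auto
    also have "\<dots> \<le> ennreal q" using cm Fm by (auto simp: IK simp flip: ennreal_mult intro!: ennreal_leI)
    finally show ?thesis .
  qed
  have Ig: "?I (\<lambda>x. g x - f x) \<le> ennreal (2 * q)"
  proof -
    \<comment> \<open>The difference is 0 on \<open>E k \<inter> D\<close> and \<open>- f\<close>
      elsewhere: points off \<open>D\<close> are charged to the tail of \<open>f\<close>, points of
      \<open>D - E k\<close> to the bound \<open>C\<close>.\<close>
    have "?I (\<lambda>x. g x - f x) \<le> (\<integral>\<^sup>+x. ennreal (norm (f x) powr p) * indicator (- D) x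
        + ennreal C * indicator (D \<union> K - E k) x \<partial>M)"
      using D(3) by (intro nn_integral_mono) (auto simp: g_def indicator_def intro!: ennreal_leI)
    also have "\<dots> = (\<integral>\<^sup>+x. ennreal (norm (f x) powr p) * indicator (- D) x \<partial>M)
        + ennreal C * emeasure M (D \<union> K - E k)"
      by (subst nn_integral_add) (auto simp: nn_integral_cmult_indicator)
    also have "\<dots> \<le> ennreal q + ennreal C * ennreal (q / (C + 1))"
      using D(4) k(1) by (intro add_mono mult_left_mono) auto
    also have "\<dots> = ennreal (q + C * (q / (C + 1)))"
      using D(2) q by (simp flip: ennreal_plus ennreal_mult)
    also have "\<dots> \<le> ennreal (2 * q)"
      using D(2) q by (intro ennreal_leI) (simp add: divide_simps algebra_simps)
    finally show ?thesis .
  qed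
  have Ivt: "?I (\<lambda>x. v (x + t)) \<le> ennreal r"
    using Iv right_haar_nn_integral_translate[OF M, of "\<lambda>x. ennreal (norm (v x) powr p)" t] by simp
  have Iut: "?I (\<lambda>x. u (x - t)) \<le> ennreal q"
    using Iu right_haar_nn_integral_translate[OF M, of "\<lambda>x. ennreal (norm (u x) powr p)" "- t"] by simp
  have vt: "(\<lambda>x. v (x + t)) \<in> Lp M p"
    using Ivt by (auto simp: Lp_iff_nn_integral less_top intro: order.strict_trans1)
  have \<chi>: "indicator K \<in> Lp M p"
    by (auto simp: Lp_iff_nn_integral IK)
  have zL: "z \<in> Lp M p"
    using Lp_add[OF \<chi> vt] p by (simp add: z_def[abs_def])
  have root: "r powr (1 / p) = e" using e p by (simp add: r_def powr_powr)
  have "?I (\<lambda>x. u (x - t) + (g x - f x))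
      \<le> ennreal (2 powr p) * (?I (\<lambda>x. u (x - t)) + ?I (\<lambda>x. g x - f x))"
    using p by (intro nn_integral_norm_add_powr_le) auto
  also have "\<dots> \<le> ennreal (2 powr p) * (ennreal q + ennreal (2 * q))"
    using Iut Ig by (intro mult_left_mono add_mono) auto
  also have "\<dots> = ennreal r"
    using q by (simp add: q_def flip: ennreal_plus ennreal_mult)
  finally have "Lp_norm M p (\<lambda>x. u (x - t) + (g x - f x)) \<le> r powr (1 / p)"
    using p r by (intro Lp_norm_le) auto
  then have "Lp_dist M p ((weighted_translation a \<omega> ^^ n k) z) f \<le> e"
    by (simp add: Lp_dist_def Tz root add_diff_eq)
  moreover have "Lp_norm M p (\<lambda>x. v (x + t)) \<le> r powr (1 / p)"
    using p r Ivt by (intro Lp_norm_le) auto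
  then have "Lp_dist M p z (indicator K) \<le> e"
    by (simp add: Lp_dist_def z_def root)
  ultimately show ?thesis using nk zL by blast
qed

theorem theorem2p3:
  fixes M :: "'a::{topological_group_add, t2_space} measure"
    and p :: real
    and a :: 'a
    and \<omega> :: "'a \<Rightarrow> real"
    and K :: "'a set"
  assumes "locally_compact_space (euclidean :: 'a topology)"
    and "right_haar_measure M"
    and "1 \<le> p"
    and "passes_through_compacts a"
    and "is_weight \<omega>"
    and "bounded_linear_on_Lp M p (weighted_translation a \<omega>)"
    and "compact K" and "0 < emeasure M K"
    and "\<And>\<Delta>. compact \<Delta> \<Longrightarrow> 0 < emeasure M \<Delta> \<Longrightarrow>
      \<exists>(E :: nat \<Rightarrow> 'a set) (n :: nat \<Rightarrow> nat).
        (\<forall>k. E k \<in> sets borel \<and> E k \<subseteq> \<Delta>) \<and>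
        strict_mono n \<and> (\<forall>k. 0 < n k) \<and>
        (\<lambda>k. emeasure M (E k)) \<longlonglongrightarrow> emeasure M \<Delta> \<and>
        (\<lambda>k. esssup_on M (E k) (weight_bwd a \<omega> (n k))) \<longlonglongrightarrow> 0 \<and>
        (\<lambda>k. esssup_on M K (weight_fwd a \<omega> (n k))) \<longlonglongrightarrow> 0"
  shows "J_class (Lp M p) (Lp_dist M p) (weighted_translation a \<omega>) \<and>
         J_vector (Lp M p) (Lp_dist M p) (weighted_translation a \<omega>) (indicator K :: 'a \<Rightarrow> complex)"
proof -
  let ?T = "weighted_translation a \<omega>"
  have sets: "sets M = sets borel"
    using assms(2) by (simp add: right_haar_measure_def radon_measure_def)
  have K: "K \<in> sets M" "emeasure M K < \<infinity>"
    using assms(2,7) by (auto simp: sets compact_imp_closed right_haar_measure_def radon_measure_def)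
  have "(\<integral>\<^sup>+x. ennreal (norm (indicator K x :: complex) powr p) \<partial>M) = (\<integral>\<^sup>+x. indicator K x \<partial>M)"
    by (intro nn_integral_cong) (auto simp: indicator_def)
  then have \<chi>: "indicator K \<in> Lp M p"
    using K by (auto simp: Lp_iff_nn_integral)
  have pos: "0 < emeasure M (D \<union> K)" if "compact D" for D
  proof -
    have "emeasure M K \<le> emeasure M (D \<union> K)"
      using that K by (intro emeasure_mono) (auto simp: sets compact_imp_closed)
    then show ?thesis using assms(8) by (rule order.strict_trans2[rotated])
  qed
  have "f \<in> extended_limit_set (Lp M p) (Lp_dist M p) ?T (indicator K)" if f: "f \<in> Lp M p" for f
  proof (rule extended_limit_setI[OF f])
    show "\<exists>n>N. \<exists>z\<in>Lp M p. Lp_dist M p z (indicator K) \<le> e \<and> Lp_dist M p ((?T ^^ n) z) f \<le> e"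
      if "0 < e" for e N
    proof (rule weighted_translation_approx[OF assms(2) _ assms(5,7) f that])
      show "0 < p" using assms(3) by simp
      show "\<exists>E n. (\<forall>k. E k \<in> sets borel \<and> E k \<subseteq> D \<union> K) \<and> strict_mono n \<and>
        (\<lambda>k. emeasure M (E k)) \<longlonglongrightarrow> emeasure M (D \<union> K) \<and>
        (\<lambda>k. esssup_on M (E k) (weight_bwd a \<omega> (n k))) \<longlonglongrightarrow> 0 \<and>
        (\<lambda>k. esssup_on M K (weight_fwd a \<omega> (n k))) \<longlonglongrightarrow> 0" if "compact D" for D
        using assms(9)[OF compact_Un[OF that assms(7)] pos[OF that]] by blast
    qed
  qed (simp add: Lp_dist_def Lp_norm_def)
  then have "J_vector (Lp M p) (Lp_dist M p) ?T (indicator K :: 'a \<Rightarrow> complex)"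
    using \<chi> by (auto simp: J_vector_def extended_limit_set_def)
  then show ?thesis by (auto simp: J_class_def)
qed

end
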